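(* For every $n\ge1$, $\mathrm{Id}(G_1(M_n(\mathbb{F}\mathbb{Z}_2)))=\mathrm{Id}(M_n)$.
   Context: $\mathbb{F}$ is an algebraically closed field of characteristic zero. $\mathrm{Id}(\mathcal{A})$ is the set of (ordinary, ungraded) associative polynomial identities of $\mathcal{A}$; $M_n=M_n(\mathbb{F})$. $G_1$ is the unital Grassmann algebra on one generator $e_1$ (so $e_1^2=0$), with $(G_1)^0=\mathbb{F}1$ and $(G_1)^1=\mathbb{F}e_1$. For a $\mathbb{Z}_2$-graded algebra $\mathcal{A}=\mathcal{A}^0\oplus\mathcal{A}^1$, $G_1(\mathcal{A})=(G_1)^0\otimes\mathcal{A}^0\oplus(G_1)^1\otimes\mathcal{A}^1$. $M_n(\mathbb{F}\mathbb{Z}_2)=M_n(\mathbb{F})\oplus\varepsilon M_n(\mathbb{F})$, $\varepsilon^2=1$ ($\varepsilon$ central), with even part $M_n(\mathbb{F})$ and odd part $\varepsilon M_n(\mathbb{F})$. *)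

theory Defs
  imports
    "HOL-Library.Poly_Mapping"
    "HOL-Library.Z2"
    "HOL-Computational_Algebra.Polynomial"
    "Jordan_Normal_Form.Matrix"
begin

section \<open>Polynomial identities\<close>

text \<open>
  Algebras over the field \<open>'f\<close> are presented by module records, whose ring part is in general
  noncommutative. A word \<open>[i, j, \<dots>]\<close> stands for the monomial \<open>X\<^sub>i X\<^sub>j \<dots>\<close>, so that finitely
  supported functions on words are the elements of the free unital associative algebra on
  countably many variables. On unital algebras the empty word is evaluated as the unit.
\<close>

type_synonym 'f free_algebra = "nat list \<Rightarrow>\<^sub>0 'f"

definition eval_word :: "('f, 'b, 'm) module_scheme \<Rightarrow> (nat \<Rightarrow> 'b) \<Rightarrow> nat list \<Rightarrow> 'b" where
  "eval_word A \<phi> w = foldr (\<lambda>i y. \<phi> i \<otimes>\<^bsub>A\<^esub> y) w \<one>\<^bsub>A\<^esub>"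

definition eval_poly ::
  "('f::zero, 'b, 'm) module_scheme \<Rightarrow> (nat \<Rightarrow> 'b) \<Rightarrow> 'f free_algebra \<Rightarrow> 'b" where
  "eval_poly A \<phi> f =
     (\<Oplus>\<^bsub>A\<^esub>w\<in>Poly_Mapping.keys f. Poly_Mapping.lookup f w \<odot>\<^bsub>A\<^esub> eval_word A \<phi> w)"

definition poly_ids :: "('f::zero, 'b, 'm) module_scheme \<Rightarrow> 'f free_algebra set" where
  "poly_ids A = {f. \<forall>\<phi>. range \<phi> \<subseteq> carrier A \<longrightarrow> eval_poly A \<phi> f = \<zero>\<^bsub>A\<^esub>}"


section \<open>Superalgebras and the envelope by the Grassmann algebra on one generator\<close>

record ('f, 'b) superalgebra = "('f, 'b) module" +
  even_part :: "'b set"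
  odd_part :: "'b set"

text \<open>The pair \<open>(a, b)\<close> is \<open>a 1 + b e\<^sub>1\<close>.\<close>

definition grassmann1 :: "('f::comm_ring_1, 'f \<times> 'f) superalgebra" where
  "grassmann1 = \<lparr>
     carrier = UNIV,
     mult = (\<lambda>(a, b) (c, d). (a * c, a * d + b * c)),
     one = (1, 0),
     zero = (0, 0),
     add = (\<lambda>(a, b) (c, d). (a + c, b + d)),
     smult = (\<lambda>s (a, b). (s * a, s * b)),
     even_part = range (\<lambda>a. (a, 0)),
     odd_part = range (\<lambda>b. (0, b))\<rparr>"

abbreviation e1 :: "'f::comm_ring_1 \<times> 'f" where
  "e1 \<equiv> (0, 1)"

text \<open>
  Since \<open>1, e\<^sub>1\<close> is a basis of \<open>G\<^sub>1\<close>, every element of \<open>G\<^sub>1 \<otimes> A\<close> is uniquely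
  \<open>1 \<otimes> x + e\<^sub>1 \<otimes> y\<close>; it is represented by the pair \<open>(x, y)\<close>. The function \<open>tens A\<close> gives
  the pure tensors in this representation, and \<open>tens_mult A\<close> is the bilinear extension of
  \<open>(g \<otimes> x) (h \<otimes> y) = g h \<otimes> x y\<close>.
\<close>

definition tens :: "('f, 'b, 'm) module_scheme \<Rightarrow> 'f \<times> 'f \<Rightarrow> 'b \<Rightarrow> 'b \<times> 'b" where
  "tens A g x = (fst g \<odot>\<^bsub>A\<^esub> x, snd g \<odot>\<^bsub>A\<^esub> x)"

definition tens_add :: "('f, 'b, 'm) module_scheme \<Rightarrow> 'b \<times> 'b \<Rightarrow> 'b \<times> 'b \<Rightarrow> 'b \<times> 'b" where
  "tens_add A u v = (fst u \<oplus>\<^bsub>A\<^esub> fst v, snd u \<oplus>\<^bsub>A\<^esub> snd v)"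

definition tens_mult ::
  "('f::comm_ring_1, 'b, 'm) module_scheme \<Rightarrow> 'b \<times> 'b \<Rightarrow> 'b \<times> 'b \<Rightarrow> 'b \<times> 'b" where
  "tens_mult A u v =
     tens_add A
       (tens_add A
         (tens A (\<one>\<^bsub>grassmann1\<^esub> \<otimes>\<^bsub>grassmann1\<^esub> \<one>\<^bsub>grassmann1\<^esub>) (fst u \<otimes>\<^bsub>A\<^esub> fst v))
         (tens A (\<one>\<^bsub>grassmann1\<^esub> \<otimes>\<^bsub>grassmann1\<^esub> e1) (fst u \<otimes>\<^bsub>A\<^esub> snd v)))
       (tens_add A
         (tens A (e1 \<otimes>\<^bsub>grassmann1\<^esub> \<one>\<^bsub>grassmann1\<^esub>) (snd u \<otimes>\<^bsub>A\<^esub> fst v))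
         (tens A (e1 \<otimes>\<^bsub>grassmann1\<^esub> e1) (snd u \<otimes>\<^bsub>A\<^esub> snd v)))"

text \<open>
  As the two homogeneous parts of \<open>G\<^sub>1\<close> are lines, every element of \<open>G\<^sub>1\<^sup>i \<otimes> A\<^sup>i\<close> is a pure tensor.
\<close>

definition envelope1 :: "('f::comm_ring_1, 'b, 'm) superalgebra_scheme \<Rightarrow> ('f, 'b \<times> 'b) module" where
  "envelope1 A = \<lparr>
     carrier = {tens_add A (tens A g x) (tens A h y) | g x h y.
       g \<in> even_part grassmann1 \<and> x \<in> even_part A \<and> h \<in> odd_part grassmann1 \<and> y \<in> odd_part A},
     mult = tens_mult A,
     one = tens A \<one>\<^bsub>grassmann1\<^esub> \<one>\<^bsub>A\<^esub>,
     zero = (\<zero>\<^bsub>A\<^esub>, \<zero>\<^bsub>A\<^esub>),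
     add = tens_add A,
     smult = (\<lambda>s u. (s \<odot>\<^bsub>A\<^esub> fst u, s \<odot>\<^bsub>A\<^esub> snd u))\<rparr>"


section \<open>Matrix algebras\<close>

abbreviation mat_alg :: "nat \<Rightarrow> ('f::field, 'f mat) module" where
  "mat_alg n \<equiv> module_mat TYPE('f) n n"

text \<open>
  The group algebra of the additive group \<open>bit\<close>, with its convolution product;
  \<open>Poly_Mapping.single\<close> embeds the scalars at the neutral element \<open>0\<close>, and
  \<open>\<epsilon>\<close> is the group element \<open>1\<close>.
\<close>

type_synonym 'f group_alg_Z2 = "bit \<Rightarrow>\<^sub>0 'f"

definition scalar_Z2 :: "'f::comm_ring_1 \<Rightarrow> 'f group_alg_Z2" where
  "scalar_Z2 c = Poly_Mapping.single 0 c"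

definition eps :: "'f::comm_ring_1 group_alg_Z2" where
  "eps = Poly_Mapping.single 1 1"

definition mat_Z2 :: "nat \<Rightarrow> ('f::field, 'f group_alg_Z2 mat) superalgebra" where
  "mat_Z2 n = \<lparr>
     carrier = carrier_mat n n,
     mult = (*),
     one = 1\<^sub>m n,
     zero = 0\<^sub>m n n,
     add = (+),
     smult = (\<lambda>c M. scalar_Z2 c \<cdot>\<^sub>m M),
     even_part = map_mat scalar_Z2 ` carrier_mat n n,
     odd_part = (\<lambda>M. eps \<cdot>\<^sub>m map_mat scalar_Z2 M) ` carrier_mat n n\<rparr>"

lemma eps_square: "eps * eps = 1"
  by (simp add: eps_def mult_single)

lemma group_alg_Z2_decomp:
  fixes x :: "'f::comm_ring_1 group_alg_Z2"
  shows "x = scalar_Z2 a + eps * scalar_Z2 b \<longleftrightarrow>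
    a = Poly_Mapping.lookup x 0 \<and> b = Poly_Mapping.lookup x 1"
proof -
  let ?y = "scalar_Z2 a + eps * scalar_Z2 b"
  have y: "Poly_Mapping.lookup ?y 0 = a" "Poly_Mapping.lookup ?y 1 = b"
    by (simp_all add: scalar_Z2_def eps_def mult_single lookup_add lookup_single)
  have "x = ?y" if *: "a = Poly_Mapping.lookup x 0" "b = Poly_Mapping.lookup x 1"
  proof (rule poly_mapping_eqI)
    show "Poly_Mapping.lookup x k = Poly_Mapping.lookup ?y k" for k
      by (cases k) (simp_all only: y *[symmetric])
  qed
  with y show ?thesis by metis
qed

lemma e1_square: "e1 \<otimes>\<^bsub>grassmann1\<^esub> e1 = \<zero>\<^bsub>grassmann1\<^esub>"
  by (simp add: grassmann1_def)

lemma scalar_Z2_simps: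
  "scalar_Z2 0 = 0" "scalar_Z2 1 = 1"
  "scalar_Z2 (a + b) = scalar_Z2 a + scalar_Z2 b"
  "scalar_Z2 (a * b) = scalar_Z2 a * scalar_Z2 b"
  by (simp_all add: scalar_Z2_def single_add mult_single)

lemma tens_mult_tens:
  assumes "x \<in> carrier (mat_Z2 n)" "y \<in> carrier (mat_Z2 n)"
  shows "tens_mult (mat_Z2 n) (tens (mat_Z2 n) g x) (tens (mat_Z2 n) h y) =
    tens (mat_Z2 n) (g \<otimes>\<^bsub>grassmann1\<^esub> h) (x \<otimes>\<^bsub>mat_Z2 n\<^esub> y)"
proof -
  have xy: "x \<in> carrier_mat n n" "y \<in> carrier_mat n n"
    using assms by (simp_all add: mat_Z2_def)
  have "x * y \<in> carrier_mat n n" using xy by simp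
  then have dim: "dim_row (x * y) = n" "dim_col (x * y) = n" by blast+
  have sm: "(a \<cdot>\<^sub>m x) * (b \<cdot>\<^sub>m y) = (a * b) \<cdot>\<^sub>m (x * y)" for a b
  proof -
    have "(a \<cdot>\<^sub>m x) * (b \<cdot>\<^sub>m y) = b \<cdot>\<^sub>m (a \<cdot>\<^sub>m (x * y))"
      using xy by (simp add: mult_smult_assoc_mat[of _ n n] mult_smult_distrib[of _ n n])
    also have "\<dots> = (a * b) \<cdot>\<^sub>m (x * y)"
      by (intro eq_matI) (simp_all add: ac_simps del: index_mult_mat)
    finally show ?thesis .
  qed
  obtain a b c d where gh: "g = (a, b)" "h = (c, d)" by (cases g, cases h)
  define z where "z = x * y"
  have z: "dim_row z = n" "dim_col z = n" using dim by (simp_all add: z_def)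
  have smz: "(a \<cdot>\<^sub>m x) * (b \<cdot>\<^sub>m y) = (a * b) \<cdot>\<^sub>m z" for a b
    by (simp only: sm z_def)
  have first: "((scalar_Z2 1 \<cdot>\<^sub>m (scalar_Z2 (a * c) \<cdot>\<^sub>m z)) + (scalar_Z2 0 \<cdot>\<^sub>m (scalar_Z2 (a * d) \<cdot>\<^sub>m z)))
     + ((scalar_Z2 0 \<cdot>\<^sub>m (scalar_Z2 (b * c) \<cdot>\<^sub>m z)) + (scalar_Z2 0 \<cdot>\<^sub>m (scalar_Z2 (b * d) \<cdot>\<^sub>m z)))
     = scalar_Z2 (a * c) \<cdot>\<^sub>m z"
    by (intro eq_matI) (simp_all add: scalar_Z2_simps)
  have second: "((scalar_Z2 0 \<cdot>\<^sub>m (scalar_Z2 (a * c) \<cdot>\<^sub>m z)) + (scalar_Z2 1 \<cdot>\<^sub>m (scalar_Z2 (a * d) \<cdot>\<^sub>m z)))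
     + ((scalar_Z2 1 \<cdot>\<^sub>m (scalar_Z2 (b * c) \<cdot>\<^sub>m z)) + (scalar_Z2 0 \<cdot>\<^sub>m (scalar_Z2 (b * d) \<cdot>\<^sub>m z)))
     = scalar_Z2 (a * d + b * c) \<cdot>\<^sub>m z"
    by (intro eq_matI) (simp_all add: scalar_Z2_simps distrib_right)
  show ?thesis
    using first second
    by (simp add: gh mat_Z2_def grassmann1_def tens_mult_def tens_add_def tens_def
        smz scalar_Z2_simps(4)[symmetric] z_def[symmetric])
qed

end

theory Submission
  imports Defs "HOL-Algebra.QuotRing"
begin

text \<open>
  Writing \<open>t\<close> for \<open>e\<^sub>1 \<otimes> \<epsilon>\<close>, the elements of \<open>G\<^sub>1(M\<^sub>n(F\<int>\<^sub>2))\<close> are \<open>a + t b\<close> with matrices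
  \<open>a, b\<close> over \<open>F\<close>, and \<open>t\<close> is central with \<open>t\<^sup>2 = 0\<close>. So the envelope is \<open>M\<^sub>n(F[t]/(t\<^sup>2))\<close>,
  and the theorem is an instance of the stability of identities under commutative
  extension of scalars over an infinite field. Three facts carry the argument:

  \<^item> \<open>M\<^sub>n(F)\<close> embeds into the envelope as the matrices constant in \<open>t\<close>;
  \<^item> the envelope is the quotient of \<open>M\<^sub>n(F[t])\<close> that truncates at \<open>t\<^sup>2\<close>
    (\<open>trunc_alg_hom\<close>, \<open>trunc_image\<close>);
  \<^item> \<open>M\<^sub>n(F[t])\<close> is separated by the evaluations \<open>t \<mapsto> s\<close> into \<open>M\<^sub>n(F)\<close>, because a polynomial
    with infinitely many roots vanishes.

  Subalgebras and quotients inherit identities, and an algebra separated by its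
  homomorphisms into another satisfies all identities of the latter. Taken in reverse order,
  the three items give
  \<open>Id(M\<^sub>n) \<subseteq> Id(M\<^sub>n(F[t])) \<subseteq> Id(envelope) \<subseteq> Id(M\<^sub>n)\<close>.
\<close>

section \<open>Polynomial identities and algebra homomorphisms\<close>

definition alg_hom :: "('f, 'a, 'm) module_scheme \<Rightarrow> ('f, 'b, 'k) module_scheme \<Rightarrow> ('a \<Rightarrow> 'b) set" where
  "alg_hom A B =
     {h \<in> ring_hom A B. \<forall>c. \<forall>x\<in>carrier A. h (c \<odot>\<^bsub>A\<^esub> x) = c \<odot>\<^bsub>B\<^esub> h x}"

lemma alg_hom_ring_hom: "h \<in> alg_hom A B \<Longrightarrow> h \<in> ring_hom A B"
  by (simp add: alg_hom_def)

lemma alg_hom_smult: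
  "h \<in> alg_hom A B \<Longrightarrow> x \<in> carrier A \<Longrightarrow> h (c \<odot>\<^bsub>A\<^esub> x) = c \<odot>\<^bsub>B\<^esub> h x"
  by (simp add: alg_hom_def)

lemma alg_hom_comp:
  assumes "g \<in> alg_hom A B" "h \<in> alg_hom B C"
  shows "(\<lambda>x. h (g x)) \<in> alg_hom A C"
  using assms by (auto simp: alg_hom_def ring_hom_def Pi_iff)

lemma eval_word_closed:
  assumes "ring A" "range \<phi> \<subseteq> carrier A"
  shows "eval_word A \<phi> w \<in> carrier A"
proof -
  interpret ring A by fact
  show ?thesis
    using assms(2) by (induction w) (auto simp: eval_word_def)
qed

lemma eval_word_hom:
  assumes "ring A" "h \<in> ring_hom A B" "range \<phi> \<subseteq> carrier A"
  shows "h (eval_word A \<phi> w) = eval_word B (\<lambda>i. h (\<phi> i)) w"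
proof (induction w)
  case Nil
  show ?case using ring_hom_one[OF assms(2)] by (simp add: eval_word_def)
next
  case (Cons i w)
  have "h (\<phi> i \<otimes>\<^bsub>A\<^esub> eval_word A \<phi> w) = h (\<phi> i) \<otimes>\<^bsub>B\<^esub> h (eval_word A \<phi> w)"
    using assms eval_word_closed[OF assms(1,3)] by (intro ring_hom_mult) auto
  with Cons show ?case by (simp add: eval_word_def)
qed

lemma eval_poly_closed:
  assumes "ring A" "\<And>c x. x \<in> carrier A \<Longrightarrow> c \<odot>\<^bsub>A\<^esub> x \<in> carrier A"
    and "range \<phi> \<subseteq> carrier A"
  shows "eval_poly A \<phi> f \<in> carrier A"
proof -
  interpret ring A by fact
  show ?thesis
    using assms(2) eval_word_closed[OF assms(1,3)]
    by (auto simp: eval_poly_def intro!: finsum_closed)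
qed

lemma ring_hom_finsum:
  assumes "ring A" "ring B" "h \<in> ring_hom A B" and g: "g \<in> S \<rightarrow> carrier A"
  shows "h (\<Oplus>\<^bsub>A\<^esub>w\<in>S. g w) = (\<Oplus>\<^bsub>B\<^esub>w\<in>S. h (g w))"
proof -
  interpret ring_hom_ring A B h
    using assms(1-3) by (rule ring_hom_ringI2)
  show ?thesis
    using g by (induction S rule: infinite_finite_induct) (auto simp: Pi_def)
qed

lemma eval_poly_hom:
  assumes A: "ring A" "\<And>c x. x \<in> carrier A \<Longrightarrow> c \<odot>\<^bsub>A\<^esub> x \<in> carrier A"
    and B: "ring B" and h: "h \<in> alg_hom A B" and \<phi>: "range \<phi> \<subseteq> carrier A"
  shows "h (eval_poly A \<phi> f) = eval_poly B (\<lambda>i. h (\<phi> i)) f"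
proof -
  note hr = alg_hom_ring_hom[OF h]
  note w = eval_word_closed[OF A(1) \<phi>]
  have "h (eval_poly A \<phi> f) =
      (\<Oplus>\<^bsub>B\<^esub>w\<in>Poly_Mapping.keys f. h (Poly_Mapping.lookup f w \<odot>\<^bsub>A\<^esub> eval_word A \<phi> w))"
    unfolding eval_poly_def using w A(2) by (intro ring_hom_finsum[OF A(1) B hr]) auto
  also have "\<dots> = eval_poly B (\<lambda>i. h (\<phi> i)) f"
    unfolding eval_poly_def by (simp add: alg_hom_smult[OF h w] eval_word_hom[OF A(1) hr \<phi>])
  finally show ?thesis .
qed

text \<open>
  A value of \<open>f\<close> in \<open>A\<close> is carried by every \<open>h \<in> H\<close> to a value of \<open>f\<close> in \<open>B\<close>, hence to zero.
  A singleton \<open>H\<close> is the case of an embedding.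
\<close>

lemma poly_ids_subset_of_separating_homs:
  assumes A: "ring A" "\<And>c x. x \<in> carrier A \<Longrightarrow> c \<odot>\<^bsub>A\<^esub> x \<in> carrier A"
    and B: "ring B" and H: "H \<subseteq> alg_hom A B"
    and sep: "\<And>x. x \<in> carrier A \<Longrightarrow> (\<And>h. h \<in> H \<Longrightarrow> h x = \<zero>\<^bsub>B\<^esub>) \<Longrightarrow> x = \<zero>\<^bsub>A\<^esub>"
  shows "poly_ids B \<subseteq> poly_ids A"
proof (clarsimp simp only: poly_ids_def)
  fix f and \<phi> :: "nat \<Rightarrow> _"
  assume f: "\<forall>\<phi>. range \<phi> \<subseteq> carrier B \<longrightarrow> eval_poly B \<phi> f = \<zero>\<^bsub>B\<^esub>" and \<phi>: "range \<phi> \<subseteq> carrier A"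
  show "eval_poly A \<phi> f = \<zero>\<^bsub>A\<^esub>"
  proof (rule sep[OF eval_poly_closed[OF A \<phi>]])
    fix h assume "h \<in> H"
    then have h: "h \<in> alg_hom A B" using H by blast
    have "range (\<lambda>i. h (\<phi> i)) \<subseteq> carrier B"
      using h \<phi> by (auto simp: alg_hom_def ring_hom_def)
    then show "h (eval_poly A \<phi> f) = \<zero>\<^bsub>B\<^esub>"
      using f eval_poly_hom[OF A B h \<phi>] by simp
  qed
qed

text \<open>Every assignment of the variables in \<open>B\<close> lifts along \<open>h\<close> to one in \<open>A\<close>.\<close>

lemma poly_ids_subset_of_surj_hom:
  assumes A: "ring A" "\<And>c x. x \<in> carrier A \<Longrightarrow> c \<odot>\<^bsub>A\<^esub> x \<in> carrier A"
    and B: "ring B" and h: "h \<in> alg_hom A B" and surj: "h ` carrier A = carrier B"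
  shows "poly_ids A \<subseteq> poly_ids B"
proof (clarsimp simp only: poly_ids_def)
  fix f and \<psi> :: "nat \<Rightarrow> _"
  assume f: "\<forall>\<phi>. range \<phi> \<subseteq> carrier A \<longrightarrow> eval_poly A \<phi> f = \<zero>\<^bsub>A\<^esub>" and \<psi>: "range \<psi> \<subseteq> carrier B"
  have "\<forall>i. \<exists>x. x \<in> carrier A \<and> h x = \<psi> i"
    using \<psi> surj by (metis image_iff range_subsetD)
  then obtain \<phi> where \<phi>: "\<And>i. \<phi> i \<in> carrier A" "\<And>i. h (\<phi> i) = \<psi> i" by metis
  then have r: "range \<phi> \<subseteq> carrier A" by blast
  have "h \<zero>\<^bsub>A\<^esub> = \<zero>\<^bsub>B\<^esub>"
    using alg_hom_ring_hom[OF h] A(1) B by (rule ring_hom_zero)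
  then show "eval_poly B \<psi> f = \<zero>\<^bsub>B\<^esub>"
    using eval_poly_hom[OF A B h r, of f] f r by (simp add: \<phi>(2))
qed


section \<open>Matrices over the polynomial ring\<close>

text \<open>
  The algebra \<open>M\<^sub>n(F[t])\<close> regarded over \<open>F\<close>; scalars act through constant polynomials.
\<close>

definition poly_mat_alg :: "nat \<Rightarrow> ('f::field, 'f poly mat) module" where
  "poly_mat_alg n = \<lparr>
     carrier = carrier_mat n n,
     mult = (*),
     one = 1\<^sub>m n,
     zero = 0\<^sub>m n n,
     add = (+),
     smult = (\<lambda>c M. [:c:] \<cdot>\<^sub>m M)\<rparr>"

lemma ring_mat_alg: "ring (mat_alg n)"
  by (unfold_locales, insert add_inv_exists_mat, auto simp: module_mat_simps algebra_simps Units_def)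

lemma ring_poly_mat_alg: "ring (poly_mat_alg n)"
  by (unfold_locales, insert add_inv_exists_mat, auto simp: poly_mat_alg_def algebra_simps Units_def)

lemma (in semiring_hom) mat_hom_add:
  assumes "P \<in> carrier_mat m n" "Q \<in> carrier_mat m n"
  shows "mat\<^sub>h (P + Q) = mat\<^sub>h P + mat\<^sub>h Q"
  using assms by (intro eq_matI) (auto simp: hom_add)

lemma (in semiring_hom) mat_hom_smult: "mat\<^sub>h (c \<cdot>\<^sub>m P) = hom c \<cdot>\<^sub>m mat\<^sub>h P"
  by (intro eq_matI) (simp_all add: hom_mult)

lemma const_mat_alg_hom:
  "map_mat (\<lambda>c. [:c:]) \<in> alg_hom (mat_alg n) (poly_mat_alg n :: ('f::field, 'f poly mat) module)"
proof -
  interpret semiring_hom "\<lambda>c::'f. [:c:]"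
    by unfold_locales (simp_all add: one_pCons)
  show ?thesis
    by (auto simp: alg_hom_def ring_hom_def module_mat_simps poly_mat_alg_def
        mat_hom_mult[of _ n n _ n] mat_hom_add[of _ n n] mat_hom_one mat_hom_smult)
qed

lemma eval_mat_alg_hom:
  "map_mat (\<lambda>p. poly p s) \<in> alg_hom (poly_mat_alg n) (mat_alg n :: ('f::field, 'f mat) module)"
proof -
  interpret semiring_hom "\<lambda>p. poly p s"
    by unfold_locales simp_all
  show ?thesis
    by (auto simp: alg_hom_def ring_hom_def module_mat_simps poly_mat_alg_def
        mat_hom_mult[of _ n n _ n] mat_hom_add[of _ n n] mat_hom_one mat_hom_smult)
qed

text \<open>
  Characteristic zero enters only here: the field is infinite, so that an entry which vanishes
  at all its points is the zero polynomial.
\<close>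

lemma evals_separate_poly_mats:
  fixes P :: "'f::field_char_0 poly mat"
  assumes "P \<in> carrier_mat n n" "\<And>s. map_mat (\<lambda>p. poly p s) P = 0\<^sub>m n n"
  shows "P = 0\<^sub>m n n"
proof (rule eq_matI)
  fix i j assume "i < dim_row (0\<^sub>m n n :: 'f poly mat)" "j < dim_col (0\<^sub>m n n :: 'f poly mat)"
  then have ij: "i < n" "j < n" by simp_all
  have "poly (P $$ (i, j)) s = 0" for s
    using arg_cong[OF assms(2)[of s], of "\<lambda>M. M $$ (i, j)"] ij assms(1) by simp
  then show "P $$ (i, j) = 0\<^sub>m n n $$ (i, j)"
    using ij by (simp add: poly_all_0_iff_0[symmetric])
qed (use assms(1) in auto)


section \<open>The envelope as a truncation of the polynomial matrices\<close>

abbreviation scal_mat :: "'f::field mat \<Rightarrow> 'f group_alg_Z2 mat" where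
  "scal_mat \<equiv> map_mat scalar_Z2"

abbreviation coeff_mat :: "nat \<Rightarrow> 'f::field poly mat \<Rightarrow> 'f mat" where
  "coeff_mat k \<equiv> map_mat (\<lambda>p. coeff p k)"

text \<open>The quotient map sending \<open>t\<close> to \<open>e\<^sub>1 \<otimes> \<epsilon>\<close>; only the coefficients below \<open>t\<^sup>2\<close> survive.\<close>

definition trunc :: "'f::field poly mat \<Rightarrow> 'f group_alg_Z2 mat \<times> 'f group_alg_Z2 mat" where
  "trunc P = (scal_mat (coeff_mat 0 P), eps \<cdot>\<^sub>m scal_mat (coeff_mat 1 P))"

interpretation scalar_Z2: inj_semiring_hom "scalar_Z2 :: 'f::field \<Rightarrow> 'f group_alg_Z2"
proof unfold_locales
  fix a b :: 'f
  assume "scalar_Z2 a = scalar_Z2 b"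
  then show "a = b"
    by (metis lookup_single_eq scalar_Z2_def)
qed (simp_all add: scalar_Z2_simps)

interpretation coeff_0: semiring_hom "\<lambda>p::'f::field poly. coeff p 0"
  by unfold_locales (simp_all add: coeff_mult_0)

lemma coeff_mat_1_mult:
  assumes "P \<in> carrier_mat n n" "Q \<in> carrier_mat n n"
  shows "coeff_mat 1 (P * Q) = coeff_mat 0 P * coeff_mat 1 Q + coeff_mat 1 P * coeff_mat 0 Q"
  using assms
  by (intro eq_matI) (auto simp: scalar_prod_def coeff_sum coeff_mult sum.distrib)

text \<open>Because \<open>e\<^sub>1\<^sup>2 = 0\<close>, the product of the two odd components drops out.\<close>

lemma tens_mult_mat_Z2:
  assumes "X \<in> carrier_mat n n" "Y \<in> carrier_mat n n" "X' \<in> carrier_mat n n" "Y' \<in> carrier_mat n n"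
  shows "tens_mult (mat_Z2 n) (X, Y) (X', Y') = (X * X', X * Y' + Y * X')"
proof -
  have m: "1 \<cdot>\<^sub>m U + 0 \<cdot>\<^sub>m V + (0 \<cdot>\<^sub>m W + 0 \<cdot>\<^sub>m Z) = U" "0 \<cdot>\<^sub>m U + 1 \<cdot>\<^sub>m V + (1 \<cdot>\<^sub>m W + 0 \<cdot>\<^sub>m Z) = V + W"
    if "U \<in> carrier_mat n n" "V \<in> carrier_mat n n" "W \<in> carrier_mat n n" "Z \<in> carrier_mat n n"
    for U V W Z :: "'a group_alg_Z2 mat"
    using that by (auto intro!: eq_matI)
  show ?thesis
    using assms
    by (simp add: tens_mult_def tens_def tens_add_def grassmann1_def mat_Z2_def scalar_Z2_simps m)
qed

lemma trunc_mult:
  assumes P: "P \<in> carrier_mat n n" and Q: "Q \<in> carrier_mat n n"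
  shows "trunc (P * Q) = tens_mult (mat_Z2 n) (trunc P) (trunc Q)"
proof -
  let ?c = "\<lambda>k P. scal_mat (coeff_mat k P)"
  have c: "?c k P \<in> carrier_mat n n" "?c k Q \<in> carrier_mat n n" for k
    using P Q by auto
  have "?c 0 (P * Q) = ?c 0 P * ?c 0 Q"
    using P Q by (simp add: coeff_0.mat_hom_mult[of _ n n _ n] scalar_Z2.mat_hom_mult[of _ n n _ n])
  moreover have "?c 1 (P * Q) = ?c 0 P * ?c 1 Q + ?c 1 P * ?c 0 Q"
    using P Q unfolding coeff_mat_1_mult[OF P Q]
    by (simp add: scalar_Z2.mat_hom_mult[of _ n n _ n] scalar_Z2.mat_hom_add[of _ n n])
  moreover have "eps \<cdot>\<^sub>m (?c 0 P * ?c 1 Q + ?c 1 P * ?c 0 Q)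
      = ?c 0 P * (eps \<cdot>\<^sub>m ?c 1 Q) + (eps \<cdot>\<^sub>m ?c 1 P) * ?c 0 Q"
    using c by (simp add: add_smult_distrib_left_mat[of _ n n]
        mult_smult_assoc_mat[of _ n n] mult_smult_distrib[of _ n n])
  ultimately show ?thesis
    using c by (simp add: trunc_def tens_mult_mat_Z2)
qed

text \<open>
  The scalars from \<open>G\<^sub>1\<close> in the defining pure tensors can be moved into the matrices over \<open>F\<close>,
  which leaves one pair of matrices for each element.
\<close>

lemma carrier_envelope1_mat_Z2:
  "carrier (envelope1 (mat_Z2 n :: ('f::field, 'f group_alg_Z2 mat) superalgebra)) =
    {(scal_mat X, eps \<cdot>\<^sub>m scal_mat Y) | X Y. X \<in> carrier_mat n n \<and> Y \<in> carrier_mat n n}"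
    (is "carrier ?E = ?S")
proof -
  let ?A = "mat_Z2 n :: ('f, 'f group_alg_Z2 mat) superalgebra"
  have tens: "tens_add ?A (tens ?A (a, 0) (scal_mat X)) (tens ?A (0, b) (eps \<cdot>\<^sub>m scal_mat Y))
      = (scal_mat (a \<cdot>\<^sub>m X), eps \<cdot>\<^sub>m scal_mat (b \<cdot>\<^sub>m Y))"
    if "X \<in> carrier_mat n n" "Y \<in> carrier_mat n n" for a b X Y
    using that
    by (auto simp: tens_add_def tens_def mat_Z2_def scalar_Z2_simps ac_simps intro!: eq_matI)
  show ?thesis
  proof (intro equalityI subsetI)
    fix u assume "u \<in> carrier ?E"
    then obtain a b X Y where XY: "X \<in> carrier_mat n n" "Y \<in> carrier_mat n n"
      and "u = tens_add ?A (tens ?A (a, 0) (scal_mat X)) (tens ?A (0, b) (eps \<cdot>\<^sub>m scal_mat Y))"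
      by (auto simp: envelope1_def mat_Z2_def grassmann1_def)
    then have "u = (scal_mat (a \<cdot>\<^sub>m X), eps \<cdot>\<^sub>m scal_mat (b \<cdot>\<^sub>m Y))"
      by (simp only: tens)
    moreover have "a \<cdot>\<^sub>m X \<in> carrier_mat n n" "b \<cdot>\<^sub>m Y \<in> carrier_mat n n"
      using XY by simp_all
    ultimately show "u \<in> ?S" by blast
  next
    fix u assume "u \<in> ?S"
    then obtain X Y where XY: "X \<in> carrier_mat n n" "Y \<in> carrier_mat n n"
      and u: "u = (scal_mat X, eps \<cdot>\<^sub>m scal_mat Y)"
      by blast
    have one: "1 \<cdot>\<^sub>m M = M" for M :: "'f mat" by (auto intro!: eq_matI)
    have u': "u = tens_add ?A (tens ?A (1, 0) (scal_mat X)) (tens ?A (0, 1) (eps \<cdot>\<^sub>m scal_mat Y))"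
      by (simp only: tens[OF XY] one u)
    have "(1, 0) \<in> even_part (grassmann1 :: ('f, 'f \<times> 'f) superalgebra)"
      "(0, 1) \<in> odd_part (grassmann1 :: ('f, 'f \<times> 'f) superalgebra)"
      "scal_mat X \<in> even_part ?A" "eps \<cdot>\<^sub>m scal_mat Y \<in> odd_part ?A"
      using XY by (auto simp: grassmann1_def mat_Z2_def)
    with u' have "\<exists>g x h y. u = tens_add ?A (tens ?A g x) (tens ?A h y) \<and>
        g \<in> even_part (grassmann1 :: ('f, 'f \<times> 'f) superalgebra) \<and> x \<in> even_part ?A \<and>
        h \<in> odd_part (grassmann1 :: ('f, 'f \<times> 'f) superalgebra) \<and> y \<in> odd_part ?A"
      by - (rule exI, rule exI, rule exI, rule exI, intro conjI)
    then show "u \<in> carrier ?E"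
      by (simp only: envelope1_def partial_object.simps mem_Collect_eq)
  qed
qed

lemma trunc_image:
  "trunc ` carrier (poly_mat_alg n) =
    carrier (envelope1 (mat_Z2 n :: ('f::field, 'f group_alg_Z2 mat) superalgebra))"
proof -
  have "(scal_mat X, eps \<cdot>\<^sub>m scal_mat Y) \<in> trunc ` carrier_mat n n"
    if XY: "X \<in> carrier_mat n n" "Y \<in> carrier_mat n n" for X Y :: "'f mat"
  proof -
    let ?P = "mat n n (\<lambda>ij. [:X $$ ij, Y $$ ij:])"
    have "coeff_mat 0 ?P = X" "coeff_mat 1 ?P = Y" using XY by (auto intro!: eq_matI)
    then have "trunc ?P = (scal_mat X, eps \<cdot>\<^sub>m scal_mat Y)" by (simp add: trunc_def)
    from this[symmetric] show ?thesis by (rule image_eqI) simp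
  qed
  moreover have "\<exists>X Y. trunc P = (scal_mat X, eps \<cdot>\<^sub>m scal_mat Y) \<and> X \<in> carrier_mat n n \<and> Y \<in> carrier_mat n n"
    if "P \<in> carrier_mat n n" for P :: "'f poly mat"
    using that by (intro exI[of _ "coeff_mat 0 P"] exI[of _ "coeff_mat 1 P"]) (simp add: trunc_def)
  moreover have "carrier (poly_mat_alg n :: ('f, 'f poly mat) module) = carrier_mat n n"
    by (simp add: poly_mat_alg_def)
  ultimately show ?thesis
    unfolding carrier_envelope1_mat_Z2 by (simp only:) blast
qed

lemma trunc_alg_hom:
  "trunc \<in> alg_hom (poly_mat_alg n) (envelope1 (mat_Z2 n :: ('f::field, 'f group_alg_Z2 mat) superalgebra))"
    (is "_ \<in> alg_hom ?P ?E")
proof -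
  have "trunc \<in> ring_hom ?P ?E"
  proof (rule ring_hom_memI)
    show "trunc P \<in> carrier ?E" if "P \<in> carrier ?P" for P
      using that trunc_image by blast
    show "trunc (P \<otimes>\<^bsub>?P\<^esub> Q) = trunc P \<otimes>\<^bsub>?E\<^esub> trunc Q"
      if "P \<in> carrier ?P" "Q \<in> carrier ?P" for P Q
      using that by (simp add: poly_mat_alg_def envelope1_def trunc_mult)
    show "trunc (P \<oplus>\<^bsub>?P\<^esub> Q) = trunc P \<oplus>\<^bsub>?E\<^esub> trunc Q"
      if "P \<in> carrier ?P" "Q \<in> carrier ?P" for P Q
      using that
      by (auto simp: poly_mat_alg_def envelope1_def trunc_def tens_add_def mat_Z2_def
          scalar_Z2_simps distrib_left intro!: eq_matI)
    show "trunc \<one>\<^bsub>?P\<^esub> = \<one>\<^bsub>?E\<^esub>"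
      by (auto simp: poly_mat_alg_def envelope1_def trunc_def tens_def mat_Z2_def
          grassmann1_def scalar_Z2_simps intro!: eq_matI)
  qed
  moreover have "trunc (c \<odot>\<^bsub>?P\<^esub> P) = c \<odot>\<^bsub>?E\<^esub> trunc P" for c P
    by (auto simp: poly_mat_alg_def envelope1_def trunc_def mat_Z2_def
        scalar_Z2_simps ac_simps intro!: eq_matI)
  ultimately show ?thesis by (simp add: alg_hom_def)
qed

lemma trunc_zero: "trunc (0\<^sub>m n n) = \<zero>\<^bsub>envelope1 (mat_Z2 n)\<^esub>"
  by (auto simp: trunc_def envelope1_def mat_Z2_def scalar_Z2_simps intro!: eq_matI)

text \<open>
  The ring laws are inherited: the envelope is the image of a ring under a map compatible with
  the operations.
\<close>

lemma ring_envelope1_mat_Z2: "ring (envelope1 (mat_Z2 n :: ('f::field, 'f group_alg_Z2 mat) superalgebra))"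
proof -
  let ?E = "envelope1 (mat_Z2 n :: ('f, 'f group_alg_Z2 mat) superalgebra)"
  have "trunc \<in> ring_hom (poly_mat_alg n) ?E"
    by (rule alg_hom_ring_hom[OF trunc_alg_hom])
  from ring.ring_hom_imp_img_ring[OF ring_poly_mat_alg this]
  have "ring (?E\<lparr>carrier := carrier ?E, zero := trunc \<zero>\<^bsub>poly_mat_alg n\<^esub>\<rparr>)"
    by (simp only: trunc_image)
  moreover have "trunc \<zero>\<^bsub>poly_mat_alg n\<^esub> = \<zero>\<^bsub>?E\<^esub>"
    using trunc_zero by (simp add: poly_mat_alg_def)
  ultimately show ?thesis by simp
qed

lemma trunc_const_eq_zero:
  assumes "M \<in> carrier_mat n n"
    and "trunc (map_mat (\<lambda>c. [:c:]) M) = \<zero>\<^bsub>envelope1 (mat_Z2 n)\<^esub>"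
  shows "M = 0\<^sub>m n n"
proof (rule scalar_Z2.mat_hom_inj)
  have "coeff_mat 0 (map_mat (\<lambda>c. [:c:]) M) = M" by (auto intro!: eq_matI)
  then have "scal_mat M = 0\<^sub>m n n"
    using assms(2) by (simp add: trunc_def envelope1_def mat_Z2_def)
  also have "\<dots> = scal_mat (0\<^sub>m n n)" by (auto intro!: eq_matI simp: scalar_Z2_simps)
  finally show "scal_mat M = scal_mat (0\<^sub>m n n)" .
qed

theorem proposition4:
  fixes n :: nat
  assumes "n \<ge> 1"
  shows "poly_ids (envelope1 (mat_Z2 n :: ('f::{alg_closed_field, field_char_0}, 'f group_alg_Z2 mat) superalgebra))
    = poly_ids (mat_alg n :: ('f, 'f mat) module)"
proof
  let ?M = "mat_alg n :: ('f, 'f mat) module"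
  let ?P = "poly_mat_alg n :: ('f, 'f poly mat) module"
  let ?E = "envelope1 (mat_Z2 n :: ('f, 'f group_alg_Z2 mat) superalgebra)"
  have smM: "c \<odot>\<^bsub>?M\<^esub> x \<in> carrier ?M" if "x \<in> carrier ?M" for c x
    using that by (simp add: module_mat_simps)
  have smP: "c \<odot>\<^bsub>?P\<^esub> x \<in> carrier ?P" if "x \<in> carrier ?P" for c x
    using that by (simp add: poly_mat_alg_def)
  have "poly_ids ?M \<subseteq> poly_ids ?P"
  proof (rule poly_ids_subset_of_separating_homs[OF ring_poly_mat_alg smP ring_mat_alg])
    show "range (\<lambda>s. map_mat (\<lambda>p. poly p s)) \<subseteq> alg_hom ?P ?M"
      using eval_mat_alg_hom by blast
    show "P = \<zero>\<^bsub>?P\<^esub>"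
      if "P \<in> carrier ?P" "\<And>h. h \<in> range (\<lambda>s. map_mat (\<lambda>p. poly p s)) \<Longrightarrow> h P = \<zero>\<^bsub>?M\<^esub>" for P
      using evals_separate_poly_mats[of P n] that by (simp add: poly_mat_alg_def module_mat_simps)
  qed
  also have "\<dots> \<subseteq> poly_ids ?E"
    by (rule poly_ids_subset_of_surj_hom[OF ring_poly_mat_alg smP ring_envelope1_mat_Z2
          trunc_alg_hom trunc_image])
  finally show "poly_ids ?M \<subseteq> poly_ids ?E" .
  show "poly_ids ?E \<subseteq> poly_ids ?M"
  proof (rule poly_ids_subset_of_separating_homs[OF ring_mat_alg smM ring_envelope1_mat_Z2])
    show "{\<lambda>M. trunc (map_mat (\<lambda>c. [:c:]) M)} \<subseteq> alg_hom ?M ?E"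
      using alg_hom_comp[OF const_mat_alg_hom trunc_alg_hom] by simp
    show "X = \<zero>\<^bsub>?M\<^esub>"
      if "X \<in> carrier ?M" "\<And>h. h \<in> {\<lambda>M. trunc (map_mat (\<lambda>c. [:c:]) M)} \<Longrightarrow> h X = \<zero>\<^bsub>?E\<^esub>" for X
      using trunc_const_eq_zero[of X n] that by (simp add: module_mat_simps)
  qed
qed

end
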